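(* Let $D$ be a division ring with center $F$, and let $p\in F\langle\mathcal X\rangle$ be a polynomial. Suppose that $p=p_1p_2$, where $p_1,p_2\in F\langle\mathcal X\rangle$ are multilinear polynomials in disjoint sets of variables such that $$p_1(\mathrm{M}_2(F)),\ p_2(\mathrm{M}_2(F))\notin\{\{0\},\,Z(\mathrm{M}_2(F))\}.$$ Then $\mathrm{M}_2(D)=p(\mathrm{M}_2(D))$.
   Context: $F\langle\mathcal X\rangle$ is the free associative $F$-algebra on noncommuting variables $\mathcal X=\{x_1,x_2,\dots\}$. A polynomial is multilinear (in $m\ge1$ variables) if, up to naming of its $m$ distinct variables, it has the form $\sum_{\sigma\in S_m}\lambda_\sigma x_{\sigma(1)}\cdots x_{\sigma(m)}$ with $\lambda_\sigma\in F$. For an $F$-algebra $\mathcal A$ and a polynomial $p$ in $m$ variables, $p(\mathcal A)=\{p(a_1,\dots,a_m)\mid a_i\in\mathcal A\}$. $Z(\mathcal A)$ denotes the center of $\mathcal A$; $Z(\mathrm{M}_2(F))$ is the set of scalar matrices. *)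

theory Defs
  imports "HOL-Analysis.Cartesian_Space" "HOL-Library.Poly_Mapping" "HOL-Combinatorics.Permutations"
begin

typedef (overloaded) ('d::division_ring) center = "{z::'d. \<forall>x. z * x = x * z}"
  by (rule exI[of _ 0]) simp

setup_lifting type_definition_center

lemma center_mult:
  fixes y z :: "'a::division_ring"
  assumes y: "\<forall>x. y * x = x * y" and z: "\<forall>x. z * x = x * z"
  shows "\<forall>x. y * z * x = x * (y * z)"
proof
  fix x
  have "y * z * x = y * (x * z)"
    by (simp only: mult.assoc z[rule_format, of x])
  also have "\<dots> = x * (y * z)"
    by (simp only: mult.assoc[symmetric] y[rule_format, of x])
  finally show "y * z * x = x * (y * z)" .
qed

lemma center_inverse:
  fixes z :: "'a::division_ring"
  assumes z: "\<forall>x. z * x = x * z"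
  shows "\<forall>x. inverse z * x = x * inverse z"
proof (cases "z = 0")
  case False
  show ?thesis
  proof
    fix x
    have "inverse z * x = inverse z * (x * z) * inverse z"
      using False by (simp add: mult.assoc)
    also have "\<dots> = inverse z * (z * x) * inverse z"
      by (simp only: z[rule_format, of x])
    also have "\<dots> = x * inverse z"
      using False by (simp flip: mult.assoc)
    finally show "inverse z * x = x * inverse z" .
  qed
qed simp

instantiation center :: (division_ring) field
begin

lift_definition zero_center :: "'a center" is 0 by simp
lift_definition one_center :: "'a center" is 1 by simp
lift_definition plus_center :: "'a center \<Rightarrow> 'a center \<Rightarrow> 'a center" is "(+)"
  by (simp add: distrib_left distrib_right)
lift_definition uminus_center :: "'a center \<Rightarrow> 'a center" is uminus by simp
lift_definition minus_center :: "'a center \<Rightarrow> 'a center \<Rightarrow> 'a center" is "(-)"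
  by (simp add: left_diff_distrib right_diff_distrib)
lift_definition times_center :: "'a center \<Rightarrow> 'a center \<Rightarrow> 'a center" is "(*)"
  using center_mult by blast
lift_definition inverse_center :: "'a center \<Rightarrow> 'a center" is inverse
  using center_inverse by blast
definition divide_center :: "'a center \<Rightarrow> 'a center \<Rightarrow> 'a center" where
  "divide_center a b = a * inverse b"

instance
proof
  fix a b c :: "'a center"
  show "a * b * c = a * (b * c)" by transfer (rule mult.assoc)
  show "a * b = b * a" by transfer blast
  show "1 * a = a" by transfer (rule mult_1_left)
  show "a + b + c = a + (b + c)" by transfer (rule add.assoc)
  show "a + b = b + a" by transfer (rule add.commute)
  show "0 + a = a" by transfer (rule add_0_left)
  show "- a + a = 0" by transfer (rule left_minus)
  show "a - b = a + - b" by transfer (rule diff_conv_add_uminus)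
  show "(a + b) * c = a * c + b * c" by transfer (rule distrib_right)
  show "(0::'a center) \<noteq> 1" by transfer simp
  show "a \<noteq> 0 \<Longrightarrow> inverse a * a = 1" by transfer (rule left_inverse)
  show "a div b = a * inverse b" by (rule divide_center_def)
  show "inverse (0::'a center) = 0" by transfer simp
qed

end

text \<open>
  The free associative algebra is the monoid algebra of the free monoid of words. Since
  \<^typ>\<open>'a \<Rightarrow>\<^sub>0 'b\<close> is a ring for an additively written monoid of exponents,
  concatenation of words is written as addition. The letter \<^term>\<open>i::nat\<close> stands for
  the \<^term>\<open>i\<close>-th noncommuting variable.
\<close>

datatype nc_word = Word (letters: "nat list")

instantiation nc_word :: monoid_add
begin

definition zero_nc_word :: nc_word where "0 = Word []"
definition plus_nc_word :: "nc_word \<Rightarrow> nc_word \<Rightarrow> nc_word" where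
  "u + v = Word (letters u @ letters v)"

instance
  by standard (simp_all add: zero_nc_word_def plus_nc_word_def)

end

type_synonym 'f free_algebra = "nc_word \<Rightarrow>\<^sub>0 'f"

text \<open>The coefficient of the zero polynomial may be zero: \<open>\<lambda>\<close> is arbitrary in the next definition.\<close>

definition multilinear_in :: "nat set \<Rightarrow> 'f::field free_algebra \<Rightarrow> bool" where
  "multilinear_in V p \<longleftrightarrow>
    (\<exists>xs c. xs \<noteq> [] \<and> distinct xs \<and> set xs = V \<and>
      p = (\<Sum>\<sigma> | \<sigma> permutes {..<length xs}.
            Poly_Mapping.single (Word (map (\<lambda>i. xs ! \<sigma> i) [0..<length xs])) (c \<sigma>)))"

text \<open>
  Evaluation in the matrix algebra over a ring into which the coefficient field is mapped
  by \<open>\<phi>\<close>. Matrix products are written out because \<open>*\<close> on vectors is componentwise;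
  multiplying by the scalar matrix \<^term>\<open>mat c\<close> is multiplying by \<open>c\<close>.
\<close>

definition mat_eval ::
  "('f::field \<Rightarrow> 'r::ring_1) \<Rightarrow> 'f free_algebra \<Rightarrow> (nat \<Rightarrow> 'r^'n^'n) \<Rightarrow> 'r^'n^'n" where
  "mat_eval \<phi> p a =
    (\<Sum>w\<in>Poly_Mapping.keys p.
      mat (\<phi> (Poly_Mapping.lookup p w)) ** foldr (\<lambda>i M. a i ** M) (letters w) (mat 1))"

text \<open>
  All variables are assigned, but only those occurring in the polynomial matter, so this is
  the set of values \<open>p(a\<^sub>1,\<dots>,a\<^sub>m)\<close>.
\<close>

definition mat_image :: "('f::field \<Rightarrow> 'r::ring_1) \<Rightarrow> 'f free_algebra \<Rightarrow> ('r^'n^'n) set" where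
  "mat_image \<phi> p = range (mat_eval \<phi> p)"

definition mat_center :: "('r::semiring_1^'n^'n) set" where
  "mat_center = {A. \<forall>B. A ** B = B ** A}"

end

theory Submission
  imports Defs
begin

text \<open>
  Grade two by two matrices by giving the matrix unit at position \<open>(r, s)\<close> degree
  \<open>s - r\<close>. A noncentral multilinear polynomial takes, after a suitable conjugation and
  expansion, a nonzero multiple of the matrix unit at \<open>(1, 2)\<close> at homogeneous matrices.
  Conjugating by the transposition yields the unit at \<open>(2, 1)\<close>. Passing from one
  assignment to the other one variable at a time, while staying homogeneous modulo 2, produces two
  linearly independent antidiagonal values that differ in a single variable; letting this variable
  run over their combinations with coefficients in \<open>D\<close> gives all antidiagonal matrices over
  \<open>D\<close>. The same walk starting from a value with nonzero entry at \<open>(1, 1)\<close> gives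
  an invertible diagonal value. This works over every field, finite or of characteristic 2 included.

  The images over \<open>D\<close> are closed under conjugation. A diagonal matrix is a product of two
  antidiagonal ones, and any other matrix is similar to a companion matrix
  \<open>[[0, x], [1, y]]\<close>. For \<open>y = 0\<close> this is an invertible diagonal value times an
  antidiagonal matrix; for \<open>y \<noteq> 0\<close> it equals
  \<open>[[0, -x], [1, 0]] [[1, y], [0, -1]]\<close>, whose second factor is similar to the
  transposition.
\<close>

section \<open>Evaluation of multilinear polynomials\<close>

text \<open>Covers both coefficient maps used below: the identity of the field and the embedding of
  the center into the division ring. Centrality of the image replaces commutativity of
  \<open>'r\<close>.\<close>

locale central_hom =
  fixes \<phi> :: "'f::field \<Rightarrow> 'r::ring_1"
  assumes hom_add: "\<phi> (x + y) = \<phi> x + \<phi> y"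
    and hom_mult: "\<phi> (x * y) = \<phi> x * \<phi> y"
    and hom_one: "\<phi> 1 = 1"
    and hom_central: "\<phi> x * r = r * \<phi> x"
begin

lemma hom_zero: "\<phi> 0 = 0"
  using hom_add[of 0 0] by simp

lemma hom_sum: "\<phi> (sum f S) = (\<Sum>s\<in>S. \<phi> (f s))"
  by (induction S rule: infinite_finite_induct) (simp_all add: hom_zero hom_add)

end

lemma central_hom_id: "central_hom (id :: 'f::field \<Rightarrow> 'f)"
  by standard simp_all

lemma central_hom_Rep_center: "central_hom (Rep_center :: 'd::division_ring center \<Rightarrow> 'd)"
  using Rep_center
  by unfold_locales (auto simp: plus_center.rep_eq times_center.rep_eq one_center.rep_eq)

section \<open>Matrix arithmetic over a noncommutative ring and evaluation of words\<close>

lemma matrix_mult_nth: "(A ** B) $ i $ j = (\<Sum>k\<in>UNIV. A $ i $ k * B $ k $ j)"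
  by (simp add: matrix_matrix_mult_def)

lemma mat_mult_nth: "(mat k ** A) $ i $ j = k * A $ i $ j"
  for A :: "'r::semiring_1^'n^'m"
proof -
  have "(mat k ** A) $ i $ j = (\<Sum>l\<in>UNIV. if i = l then k * A $ l $ j else 0)"
    unfolding matrix_mult_nth by (rule sum.cong) (auto simp: mat_def)
  then show ?thesis by simp
qed

lemma mult_mat_nth: "(A ** mat k) $ i $ j = A $ i $ j * k"
  for A :: "'r::semiring_1^'n^'m"
proof -
  have "(A ** mat k) $ i $ j = (\<Sum>l\<in>UNIV. if l = j then A $ i $ l * k else 0)"
    unfolding matrix_mult_nth by (rule sum.cong) (auto simp: mat_def)
  then show ?thesis by simp
qed

lemma matrix_distrib_right: "(A + B) ** C = A ** C + B ** C"
  for A :: "'r::semiring_1^'n^'m"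
  by (simp add: vec_eq_iff matrix_mult_nth distrib_right sum.distrib)

lemma matrix_sum_distrib_left: "A ** sum f S = (\<Sum>s\<in>S. A ** f s)"
  for A :: "'r::semiring_1^'n^'m"
  by (induction S rule: infinite_finite_induct) (simp_all add: matrix_add_ldistrib)

lemma matrix_sum_distrib_right: "sum f S ** A = (\<Sum>s\<in>S. f s ** A)"
  for A :: "'r::semiring_1^'n^'m"
  by (induction S rule: infinite_finite_induct) (simp_all add: matrix_distrib_right)

definition word_eval :: "(nat \<Rightarrow> 'r::semiring_1^'n^'n) \<Rightarrow> nat list \<Rightarrow> 'r^'n^'n" where
  "word_eval a l = foldr (\<lambda>i M. a i ** M) l (mat 1)"

lemma word_eval_Nil [simp]: "word_eval a [] = mat 1"
  by (simp add: word_eval_def)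

lemma word_eval_Cons [simp]: "word_eval a (i # l) = a i ** word_eval a l"
  by (simp add: word_eval_def)

lemma word_eval_append: "word_eval a (l @ m) = word_eval a l ** word_eval a m"
  by (induction l) (simp_all add: matrix_mul_assoc)

lemma word_eval_cong: "(\<And>i. i \<in> set l \<Longrightarrow> a i = b i) \<Longrightarrow> word_eval a l = word_eval b l"
  by (induction l) simp_all

lemma word_eval_upd_add:
  assumes "distinct l" "i \<in> set l"
  shows "word_eval (a(i := x + y)) l = word_eval (a(i := x)) l + word_eval (a(i := y)) l"
  using assms
proof (induction l)
  case (Cons j l)
  show ?case
  proof (cases "i = j")
    case True
    then have "word_eval (a(i := z)) l = word_eval a l" for z
      using Cons.prems by (intro word_eval_cong) auto
    then have "word_eval (a(i := z)) (j # l) = z ** word_eval a l" for z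
      using True word_eval_Cons[of "a(i := z)" j l] by (simp del: word_eval_Cons)
    note upd = this[of "x + y"] this[of x] this[of y]
    show ?thesis unfolding upd by (rule matrix_distrib_right)
  next
    case False
    then show ?thesis using Cons by (simp add: matrix_add_ldistrib)
  qed
qed simp

lemma word_eval_commute:
  "(\<And>j. j \<in> set l \<Longrightarrow> a j ** N = N ** a j) \<Longrightarrow> word_eval a l ** N = N ** word_eval a l"
proof (induction l)
  case (Cons j l)
  have "a j ** word_eval a l ** N = a j ** N ** word_eval a l"
    using Cons by (metis list.set_intros(2) matrix_mul_assoc)
  then show ?case
    using Cons.prems by (simp add: matrix_mul_assoc)
qed simp

lemma word_eval_upd_mult:
  assumes "distinct l" "i \<in> set l" and N: "\<And>j. j \<noteq> i \<Longrightarrow> a j ** N = N ** a j"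
  shows "word_eval (a(i := x ** N)) l = word_eval (a(i := x)) l ** N"
  using assms(1,2)
proof (induction l)
  case (Cons j l)
  show ?case
  proof (cases "i = j")
    case True
    then have "word_eval (a(i := z)) l = word_eval a l" for z
      using Cons.prems by (intro word_eval_cong) auto
    then have "word_eval (a(i := z)) (j # l) = z ** word_eval a l" for z
      using True word_eval_Cons[of "a(i := z)" j l] by (simp del: word_eval_Cons)
    note upd = this[of "x ** N"] this[of x]
    have "word_eval a l ** N = N ** word_eval a l"
    proof (rule word_eval_commute)
      show "a k ** N = N ** a k" if "k \<in> set l" for k
        using that Cons.prems True by (intro N) auto
    qed
    then show ?thesis
      unfolding upd by (simp add: matrix_mul_assoc[symmetric])
  next
    case False
    then show ?thesis using Cons by (simp add: matrix_mul_assoc)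
  qed
qed simp

lemma word_eval_conj:
  assumes "h ** g = mat 1" "g ** h = mat 1"
  shows "word_eval (\<lambda>i. g ** a i ** h) l = g ** word_eval a l ** h"
proof (induction l)
  case (Cons j l)
  have "g ** a j ** h ** (g ** word_eval a l ** h) = g ** a j ** (h ** g) ** word_eval a l ** h"
    by (simp only: matrix_mul_assoc)
  then show ?case by (simp add: Cons assms matrix_mul_assoc)
qed (simp add: assms)

definition map_mat :: "('f \<Rightarrow> 'r) \<Rightarrow> 'f^'n^'m \<Rightarrow> 'r^'n^'m" where
  "map_mat \<phi> A = (\<chi> i j. \<phi> (A $ i $ j))"

section \<open>Evaluation of polynomials through a central coefficient map\<close>

context central_hom
begin

lemma mat_hom_commute: "mat (\<phi> x) ** A = A ** mat (\<phi> x)"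
  for A :: "'r^'n^'m"
  by (simp add: vec_eq_iff mat_mult_nth mult_mat_nth hom_central)

lemma mat_eval_superset:
  assumes "finite K" "Poly_Mapping.keys p \<subseteq> K"
  shows "mat_eval \<phi> p a =
    (\<Sum>w\<in>K. mat (\<phi> (Poly_Mapping.lookup p w)) ** word_eval a (letters w))"
  unfolding mat_eval_def word_eval_def[symmetric]
  by (rule sum.mono_neutral_left) (use assms in \<open>auto simp: in_keys_iff hom_zero\<close>)

lemma mat_eval_add: "mat_eval \<phi> (p + q) a = mat_eval \<phi> p a + mat_eval \<phi> q a"
proof -
  let ?K = "Poly_Mapping.keys p \<union> Poly_Mapping.keys q"
  have mat_add: "mat (x + y) = (mat x + mat y :: 'r^'n^'n)" for x y
    by (simp add: vec_eq_iff mat_def)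
  show ?thesis
    using Poly_Mapping.keys_add[of p q]
    by (simp add: mat_eval_superset[of ?K] lookup_add hom_add mat_add
        matrix_distrib_right sum.distrib)
qed

lemma mat_eval_single:
  "mat_eval \<phi> (Poly_Mapping.single w k) a = mat (\<phi> k) ** word_eval a (letters w)"
  by (subst mat_eval_superset[of "{w}"]) auto

lemma mat_eval_sum_single:
  "mat_eval \<phi> (\<Sum>s\<in>S. Poly_Mapping.single (w s) (k s)) a =
    (\<Sum>s\<in>S. mat (\<phi> (k s)) ** word_eval a (letters (w s)))"
  by (induction S rule: infinite_finite_induct)
    (simp_all add: mat_eval_add mat_eval_single, simp_all add: mat_eval_def)

text \<open>Expand both factors into monomials: concatenated words evaluate to products, and the
  coefficient of the second monomial passes the first word because it is central.\<close>

lemma mat_eval_mult: "mat_eval \<phi> (p * q) a = mat_eval \<phi> p a ** mat_eval \<phi> q a"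
proof -
  have expand: "r = (\<Sum>w\<in>Poly_Mapping.keys r.
      Poly_Mapping.single w (Poly_Mapping.lookup r w))" for r :: "'f free_algebra"
    by (rule poly_mapping_eqI) (auto simp: lookup_sum lookup_single when_def in_keys_iff)
  have "p * q = (\<Sum>v\<in>Poly_Mapping.keys p. \<Sum>w\<in>Poly_Mapping.keys q.
      Poly_Mapping.single (v + w) (Poly_Mapping.lookup p v * Poly_Mapping.lookup q w))"
    by (subst expand[of p], subst expand[of q])
      (simp add: sum_product mult_single)
  then have pq: "p * q = (\<Sum>x\<in>Poly_Mapping.keys p \<times> Poly_Mapping.keys q.
      Poly_Mapping.single (fst x + snd x)
        (Poly_Mapping.lookup p (fst x) * Poly_Mapping.lookup q (snd x)))"
    by (simp add: sum.cartesian_product case_prod_unfold)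
  have split: "mat (\<phi> x * \<phi> y) ** (A ** B) = (mat (\<phi> x) ** A) ** (mat (\<phi> y) ** B)"
    for x y and A B :: "'r^'n^'n"
  proof -
    have "mat (\<phi> x * \<phi> y) = (mat (\<phi> x) ** mat (\<phi> y) :: 'r^'n^'n)"
      by (simp add: vec_eq_iff mat_mult_nth) (simp add: mat_def)
    then have "mat (\<phi> x * \<phi> y) ** (A ** B) = mat (\<phi> x) ** (mat (\<phi> y) ** A) ** B"
      by (simp only: matrix_mul_assoc)
    also have "mat (\<phi> y) ** A = A ** mat (\<phi> y)"
      by (rule mat_hom_commute)
    finally show ?thesis by (simp only: matrix_mul_assoc)
  qed
  have "mat_eval \<phi> p a ** mat_eval \<phi> q a = (\<Sum>v\<in>Poly_Mapping.keys p. \<Sum>w\<in>Poly_Mapping.keys q.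
      (mat (\<phi> (Poly_Mapping.lookup p v)) ** word_eval a (letters v)) **
      (mat (\<phi> (Poly_Mapping.lookup q w)) ** word_eval a (letters w)))"
    unfolding mat_eval_def word_eval_def[symmetric]
    by (simp only: matrix_sum_distrib_left matrix_sum_distrib_right) (rule sum.swap)
  also have "\<dots> = mat_eval \<phi> (p * q) a"
    unfolding pq mat_eval_sum_single
    by (simp add: plus_nc_word_def word_eval_append hom_mult split
        sum.cartesian_product case_prod_unfold)
  finally show ?thesis ..
qed

lemma mat_eval_conj:
  assumes "h ** g = mat 1" "g ** h = mat 1"
  shows "mat_eval \<phi> p (\<lambda>i. g ** a i ** h) = g ** mat_eval \<phi> p a ** h"
  unfolding mat_eval_def word_eval_def[symmetric]
  by (simp add: matrix_sum_distrib_right matrix_sum_distrib_left word_eval_conj[OF assms]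
      matrix_mul_assoc mat_hom_commute[of _ g])

lemma mat_image_conj:
  assumes "h ** g = mat 1" "g ** h = mat 1" "A \<in> mat_image \<phi> p"
  shows "g ** A ** h \<in> mat_image \<phi> p"
proof -
  obtain a where "A = mat_eval \<phi> p a" using assms(3) by (auto simp: mat_image_def)
  then have "mat_eval \<phi> p (\<lambda>i. g ** a i ** h) = g ** A ** h"
    using mat_eval_conj[OF assms(1,2)] by simp
  then show ?thesis unfolding mat_image_def by (metis rangeI)
qed

text \<open>Applying \<open>\<phi>\<close> entrywise is a ring homomorphism on matrices, so values
  found over the field persist over \<open>'r\<close>.\<close>

lemma mat_eval_map_mat:
  "mat_eval \<phi> p (\<lambda>i. map_mat \<phi> (a i)) = map_mat \<phi> (mat_eval id p a)"
  for a :: "nat \<Rightarrow> 'f^'n^'n"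
proof -
  have hom: "map_mat \<phi> (A ** B) = map_mat \<phi> A ** map_mat \<phi> B" for A B :: "'f^'n^'n"
    by (simp add: vec_eq_iff map_mat_def matrix_mult_nth hom_sum hom_mult)
  have mat: "map_mat \<phi> (mat x) = (mat (\<phi> x) :: 'r^'n^'n)" for x
    by (simp add: vec_eq_iff map_mat_def mat_def hom_zero)
  have "map_mat \<phi> (word_eval a l) = word_eval (\<lambda>i. map_mat \<phi> (a i)) l" for l
    by (induction l) (simp_all add: hom mat hom_one)
  moreover have "map_mat \<phi> (sum f S) = (\<Sum>s\<in>S. map_mat \<phi> (f s))" for f :: "nc_word \<Rightarrow> 'f^'n^'n" and S
    by (simp add: vec_eq_iff map_mat_def hom_sum)
  ultimately show ?thesis
    unfolding mat_eval_def word_eval_def[symmetric] by (simp add: hom mat)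
qed

end

text \<open>Forgets the permutations: later arguments use only that each word contains every
  variable of \<open>V\<close> exactly once.\<close>

lemma multilinear_inE:
  assumes "multilinear_in V p"
  obtains S :: "(nat \<Rightarrow> nat) set" and l k
  where "finite S" "\<And>s. s \<in> S \<Longrightarrow> distinct (l s)" "\<And>s. s \<in> S \<Longrightarrow> set (l s) = V"
    "p = (\<Sum>s\<in>S. Poly_Mapping.single (Word (l s)) (k s))"
proof -
  obtain xs k where xs: "distinct xs" "set xs = V"
    and p: "p = (\<Sum>\<sigma> | \<sigma> permutes {..<length xs}.
      Poly_Mapping.single (Word (map (\<lambda>i. xs ! \<sigma> i) [0..<length xs])) (k \<sigma>))"
    using assms unfolding multilinear_in_def by blast
  show thesis
  proof (rule that)
    fix \<sigma> assume "\<sigma> \<in> {\<sigma>. \<sigma> permutes {..<length xs}}"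
    then have \<sigma>: "\<sigma> permutes {..<length xs}" by simp
    show "distinct (map (\<lambda>i. xs ! \<sigma> i) [0..<length xs])"
      using \<sigma> xs(1) permutes_in_image[OF \<sigma>] permutes_inj[OF \<sigma>]
      by (auto simp: distinct_map inj_on_def nth_eq_iff_index_eq dest: injD)
    have "(\<lambda>i. xs ! \<sigma> i) ` {..<length xs} = (!) xs ` \<sigma> ` {..<length xs}"
      by (simp add: image_image)
    also have "\<dots> = set xs"
      by (simp add: permutes_image[OF \<sigma>]) (auto simp: set_conv_nth)
    finally show "set (map (\<lambda>i. xs ! \<sigma> i) [0..<length xs]) = V"
      using xs(2) by (simp add: atLeast0LessThan)
  qed (use p in \<open>auto simp: finite_permutations\<close>)
qed

lemma multilinear_in_vars: "multilinear_in V p \<Longrightarrow> finite V \<and> V \<noteq> {}"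
  unfolding multilinear_in_def by auto

text \<open>Multilinearity without scalars: it applies alike to matrix values over any ring and to
  their single entries.\<close>

definition sep_additive :: "nat set \<Rightarrow> ((nat \<Rightarrow> 'm::plus) \<Rightarrow> 'n::plus) \<Rightarrow> bool" where
  "sep_additive V F \<longleftrightarrow>
    (\<forall>a b. (\<forall>i\<in>V. a i = b i) \<longrightarrow> F a = F b) \<and>
    (\<forall>a. \<forall>i\<in>V. \<forall>x y. F (a(i := x + y)) = F (a(i := x)) + F (a(i := y)))"

lemma sep_additive_cong: "sep_additive V F \<Longrightarrow> (\<And>i. i \<in> V \<Longrightarrow> a i = b i) \<Longrightarrow> F a = F b"
  unfolding sep_additive_def by blast

lemma sep_additive_upd:
  "sep_additive V F \<Longrightarrow> i \<in> V \<Longrightarrow> F (a(i := x + y)) = F (a(i := x)) + F (a(i := y))"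
  unfolding sep_additive_def by blast

lemma sep_additive_nth:
  "sep_additive V F \<Longrightarrow> sep_additive V (\<lambda>a. F a $ r $ s)"
  unfolding sep_additive_def by (metis vector_add_component)

context central_hom
begin

context
  fixes V and p :: "'f free_algebra"
  assumes p: "multilinear_in V p"
begin

lemma sep_additive_mat_eval: "sep_additive V (mat_eval \<phi> p :: (nat \<Rightarrow> 'r^'n^'n) \<Rightarrow> _)"
  using p
proof (rule multilinear_inE)
  fix S :: "(nat \<Rightarrow> nat) set" and l k
  assume S: "finite S" "\<And>s. s \<in> S \<Longrightarrow> distinct (l s)" "\<And>s. s \<in> S \<Longrightarrow> set (l s) = V"
    "p = (\<Sum>s\<in>S. Poly_Mapping.single (Word (l s)) (k s))"
  have cong: "word_eval a (l s) = word_eval b (l s)" if "s \<in> S" "\<forall>i\<in>V. a i = b i"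
    for s and a b :: "nat \<Rightarrow> 'r^'n^'n"
    using that S by (intro word_eval_cong) auto
  show ?thesis
    unfolding sep_additive_def S(4) mat_eval_sum_single
  proof (intro conjI allI impI ballI)
    fix a b :: "nat \<Rightarrow> 'r^'n^'n"
    assume "\<forall>i\<in>V. a i = b i"
    from cong[OF _ this] show "(\<Sum>s\<in>S. mat (\<phi> (k s)) ** word_eval a (letters (Word (l s)))) =
        (\<Sum>s\<in>S. mat (\<phi> (k s)) ** word_eval b (letters (Word (l s))))"
      by simp
  qed (simp add: S word_eval_upd_add matrix_add_ldistrib sum.distrib)
qed

lemma mat_eval_upd_mult:
  assumes "i \<in> V" "\<And>j. j \<noteq> i \<Longrightarrow> a j ** N = N ** a j"
  shows "mat_eval \<phi> p (a(i := x ** N)) = mat_eval \<phi> p (a(i := x)) ** N"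
  using p
proof (rule multilinear_inE)
  fix S :: "(nat \<Rightarrow> nat) set" and l k
  assume S: "finite S" "\<And>s. s \<in> S \<Longrightarrow> distinct (l s)" "\<And>s. s \<in> S \<Longrightarrow> set (l s) = V"
    "p = (\<Sum>s\<in>S. Poly_Mapping.single (Word (l s)) (k s))"
  show ?thesis
    unfolding S(4) mat_eval_sum_single
    by (simp add: matrix_sum_distrib_right S assms word_eval_upd_mult matrix_mul_assoc)
qed

end

end

section \<open>The grading of two by two matrices\<close>

definition m2 :: "'a \<Rightarrow> 'a \<Rightarrow> 'a \<Rightarrow> 'a \<Rightarrow> 'a^2^2" where
  "m2 a b c d = (\<chi> i j. if i = 1 then if j = 1 then a else b else if j = 1 then c else d)"

lemma m2_nth [simp]:
  "m2 a b c d $ 1 $ 1 = a" "m2 a b c d $ 1 $ 2 = b"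
  "m2 a b c d $ 2 $ 1 = c" "m2 a b c d $ 2 $ 2 = d"
  by (simp_all add: m2_def)

lemma eq_m2_iff:
  "A = m2 a b c d \<longleftrightarrow> A $ 1 $ 1 = a \<and> A $ 1 $ 2 = b \<and> A $ 2 $ 1 = c \<and> A $ 2 $ 2 = d"
  by (auto simp: vec_eq_iff forall_2)

lemma m2_collapse: "m2 (A $ 1 $ 1) (A $ 1 $ 2) (A $ 2 $ 1) (A $ 2 $ 2) = A"
  using eq_m2_iff by metis

lemma m2_mult:
  "m2 a b c d ** m2 a' b' c' d' =
    m2 (a * a' + b * c') (a * b' + b * d') (c * a' + d * c') (c * b' + d * d')"
  by (simp add: eq_m2_iff matrix_mult_nth sum_2)

lemma m2_add: "m2 a b c d + m2 a' b' c' d' = m2 (a + a') (b + b') (c + c') (d + d')"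
  by (simp add: eq_m2_iff)

lemma mat_eq_m2: "mat k = m2 k 0 0 k"
  by (simp add: eq_m2_iff mat_def)

lemma map_mat_m2: "map_mat \<phi> (m2 a b c d) = m2 (\<phi> a) (\<phi> b) (\<phi> c) (\<phi> d)"
  by (simp add: eq_m2_iff map_mat_def)

definition pos :: "2 \<Rightarrow> int" where
  "pos r = (if r = 1 then 0 else 1)"

text \<open>
  The matrix unit at position \<open>(r, s)\<close> has degree \<open>pos s - pos r\<close>; degrees
  are read in the integers modulo \<open>m\<close>, and are integers for \<open>m = 0\<close>.
\<close>

definition homog :: "int \<Rightarrow> int \<Rightarrow> 'a::zero^2^2 \<Rightarrow> bool" where
  "homog m w A \<longleftrightarrow> (\<forall>r s. A $ r $ s \<noteq> 0 \<longrightarrow> m dvd w - (pos s - pos r))"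

lemma homog_mult:
  assumes "homog m v A" "homog m w B"
  shows "homog m (v + w) (A ** B)"
  unfolding homog_def
proof (intro allI impI)
  fix r s assume "(A ** B) $ r $ s \<noteq> 0"
  then obtain k where "A $ r $ k * B $ k $ s \<noteq> 0"
    unfolding matrix_mult_nth using sum.not_neutral_contains_not_neutral by blast
  then have "A $ r $ k \<noteq> 0" "B $ k $ s \<noteq> 0" by auto
  \<comment> \<open>The degrees of the positions (r, k) and (k, s) telescope to that of (r,
    s).\<close>
  then have "m dvd (v - (pos k - pos r)) + (w - (pos s - pos k))"
    using assms unfolding homog_def by (intro dvd_add) auto
  then show "m dvd v + w - (pos s - pos r)" by (simp add: algebra_simps)
qed

lemma homog_mat: "homog m 0 (mat k)"
  by (auto simp: homog_def mat_def)

lemma homog_add: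
  "homog m w A \<Longrightarrow> homog m w B \<Longrightarrow> homog m w (A + B)"
  for A B :: "'a::monoid_add^2^2"
  unfolding homog_def by (metis vector_add_component add_0_left)

lemma homog_sum:
  "(\<And>s. s \<in> S \<Longrightarrow> homog m w (f s)) \<Longrightarrow> homog m w (sum f S)"
  for f :: "_ \<Rightarrow> 'a::comm_monoid_add^2^2"
proof (induction S rule: infinite_finite_induct)
  case (insert s S)
  then show ?case by (auto intro!: homog_add)
qed (simp_all add: homog_def)

lemma homog_word_eval:
  "(\<And>i. i \<in> set l \<Longrightarrow> homog m (w i) (a i)) \<Longrightarrow>
    homog m (sum_list (map w l)) (word_eval a l)"
  by (induction l) (auto intro: homog_mult homog_mat)

text \<open>Each word uses every variable of \<open>V\<close> once, so all words have the same total
  degree.\<close>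

lemma homog_mat_eval:
  assumes "multilinear_in V p" "\<And>i. i \<in> V \<Longrightarrow> homog m (w i) (a i)"
  shows "homog m (\<Sum>i\<in>V. w i) (mat_eval id p a)"
  using assms(1)
proof (rule multilinear_inE)
  fix S :: "(nat \<Rightarrow> nat) set" and l k
  assume S: "finite S" "\<And>s. s \<in> S \<Longrightarrow> distinct (l s)" "\<And>s. s \<in> S \<Longrightarrow> set (l s) = V"
    "p = (\<Sum>s\<in>S. Poly_Mapping.single (Word (l s)) (k s))"
  show ?thesis
    unfolding S(4) central_hom.mat_eval_sum_single[OF central_hom_id]
  proof (rule homog_sum)
    fix s assume s: "s \<in> S"
    have "homog m (sum_list (map w (l s))) (word_eval a (l s))"
      using assms(2) S(3)[OF s] by (intro homog_word_eval) auto
    then have "homog m (\<Sum>i\<in>V. w i) (word_eval a (l s))"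
      using S(2,3)[OF s] by (simp add: sum_list_distinct_conv_sum_set)
    then show "homog m (\<Sum>i\<in>V. w i) (mat (id (k s)) ** word_eval a (letters (Word (l s))))"
      using homog_mult[OF homog_mat] by fastforce
  qed
qed

text \<open>Split one variable after another into its components of degree 0, 1 and -1; by
  additivity one of the three keeps the value nonzero.\<close>

lemma sep_additive_homog_nonzero:
  fixes F :: "(nat \<Rightarrow> 'a::monoid_add^2^2) \<Rightarrow> 'b::monoid_add"
  assumes F: "sep_additive V F" and "finite W" "W \<subseteq> V" "F a \<noteq> 0"
  shows "\<exists>u w. (\<forall>i\<in>W. homog 0 (w i) (u i)) \<and> F u \<noteq> 0"
  using assms(2-)
proof (induction W rule: finite_induct)
  case (insert i W)
  then obtain u w where u: "\<forall>i\<in>W. homog 0 (w i) (u i)" "F u \<noteq> 0" by auto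
  define A B C where "A = m2 (u i $ 1 $ 1) 0 0 (u i $ 2 $ 2)"
    and "B = m2 0 (u i $ 1 $ 2) 0 0" and "C = m2 0 0 (u i $ 2 $ 1) 0"
  have "A + (B + C) = u i"
    unfolding A_def B_def C_def m2_add using m2_collapse[of "u i"] by simp
  then have "F u = F (u(i := A)) + (F (u(i := B)) + F (u(i := C)))"
    using sep_additive_upd[OF F, of i u] insert.prems
    by (metis fun_upd_triv insert_subset)
  with u(2) consider "F (u(i := A)) \<noteq> 0" | "F (u(i := B)) \<noteq> 0" | "F (u(i := C)) \<noteq> 0"
    by fastforce
  moreover have "homog 0 0 A" "homog 0 1 B" "homog 0 (-1) C"
    by (auto simp: homog_def forall_2 A_def B_def C_def pos_def)
  ultimately obtain M v where "F (u(i := M)) \<noteq> 0" "homog 0 v M" by metis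
  moreover from this have "\<forall>j\<in>insert i W. homog 0 ((w(i := v)) j) ((u(i := M)) j)"
    using u(1) by auto
  ultimately show ?case by blast
qed auto

section \<open>Assignments with two independent values\<close>

text \<open>
  Deform \<open>a\<close> into \<open>b\<close> one variable at a time. If no single replacement separates
  \<open>F\<close> from \<open>G\<close>, then a variable on which \<open>a\<close> and \<open>b\<close> differ can be given the
  value \<open>a i + b i\<close> in both assignments without changing the values of \<open>F\<close> and \<open>G\<close>.
\<close>

lemma sep_additive_pivot:
  fixes F G :: "(nat \<Rightarrow> 'm::plus) \<Rightarrow> 'f::field"
  assumes F: "sep_additive V F" and G: "sep_additive V G" and V: "finite V"
    and K: "\<forall>i\<in>V. \<forall>x\<in>K i. \<forall>y\<in>K i. x + y \<in> K i"
    and "\<forall>i\<in>V. a i \<in> K i" "\<forall>i\<in>V. b i \<in> K i"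
    and "F a \<noteq> 0" "G a = 0" "F b = 0" "G b \<noteq> 0"
  shows "\<exists>c i x y. i \<in> V \<and> (\<forall>j\<in>V. c j \<in> K j) \<and> x \<in> K i \<and> y \<in> K i \<and>
    F (c(i := x)) * G (c(i := y)) \<noteq> F (c(i := y)) * G (c(i := x))"
  using assms(5-)
proof (induction "card {i\<in>V. a i \<noteq> b i}" arbitrary: a b rule: less_induct)
  case less
  obtain i where i: "i \<in> V" "a i \<noteq> b i"
    using sep_additive_cong[OF F, of a b] less.prems by metis
  have less_card: "card {j\<in>V. a' j \<noteq> b' j} < card {i\<in>V. a i \<noteq> b i}"
    if "a' i = b' i" "\<forall>j. j \<noteq> i \<longrightarrow> a' j = a j \<and> b' j = b j" for a' b'
    by (rule psubset_card_mono) (use V i that in auto)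
  let ?a = "a(i := b i)" and ?b = "b(i := a i)"
  show ?case
  proof (rule ccontr)
    assume neg: "\<not> ?case"
    \<comment> \<open>With \<open>c = a\<close> and the values \<open>a i\<close>,
      \<open>b i\<close>, the negated claim reads \<open>F a * G ?a = 0\<close>; with
      \<open>c = b\<close> it reads \<open>F ?b * G b = 0\<close>.\<close>
    have Ga: "G ?a = 0"
      using neg i less.prems by (metis fun_upd_triv mult_eq_0_iff)
    have Fb: "F ?b = 0"
      using neg i less.prems by (metis fun_upd_triv mult_eq_0_iff)
    \<comment> \<open>Otherwise the induction hypothesis applies to \<open>?a\<close> and
      \<open>b\<close>, which differ at fewer variables; \<open>Gb\<close> is dual.\<close>
    have Fa: "F ?a = 0"
    proof (rule ccontr)
      assume "F ?a \<noteq> 0"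
      with less.prems Ga have ?case
        by (intro less.hyps[of ?a b, OF less_card[of ?a b]]) auto
      with neg show False ..
    qed
    have Gb: "G ?b = 0"
    proof (rule ccontr)
      assume "G ?b \<noteq> 0"
      with less.prems Fb have ?case
        by (intro less.hyps[of a ?b, OF less_card[of a ?b]]) auto
      with neg show False ..
    qed
    \<comment> \<open>All four mixed values at \<open>?a\<close> and \<open>?b\<close> vanish, so
      additivity preserves the values of \<open>F\<close> and \<open>G\<close> while
      \<open>a\<close> and \<open>b\<close> come to agree at \<open>i\<close>.\<close>
    let ?s = "a i + b i"
    have "F (a(i := ?s)) = F a" "G (a(i := ?s)) = 0"
      "F (b(i := ?s)) = 0" "G (b(i := ?s)) = G b"
      using sep_additive_upd[OF F i(1)] sep_additive_upd[OF G i(1)] Fa Fb Ga Gb less.prems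
      by simp_all
    then have ?case
      using less.prems i K by (intro less.hyps[of "a(i := ?s)" "b(i := ?s)", OF less_card[of "a(i := ?s)" "b(i := ?s)"]]) auto
    with neg show False ..
  qed
qed

text \<open>If neither \<open>a\<close> nor \<open>b\<close> works, a pivot gives \<open>x\<close>,
  \<open>y\<close> with nonzero determinant. If these fail too, the matrix of the four values is
  diagonal or antidiagonal and invertible, and \<open>x + y\<close> works.\<close>

lemma sep_additive_both_nonzero:
  fixes F G :: "(nat \<Rightarrow> 'm::plus) \<Rightarrow> 'f::field"
  assumes F: "sep_additive V F" and G: "sep_additive V G" and V: "finite V"
    and K: "\<forall>i\<in>V. \<forall>x\<in>K i. \<forall>y\<in>K i. x + y \<in> K i"
    and a: "\<forall>i\<in>V. a i \<in> K i" and b: "\<forall>i\<in>V. b i \<in> K i"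
    and "F a \<noteq> 0" "G b \<noteq> 0"
  shows "\<exists>c. (\<forall>i\<in>V. c i \<in> K i) \<and> F c \<noteq> 0 \<and> G c \<noteq> 0"
proof (cases "G a = 0 \<and> F b = 0")
  case True
  then obtain c i x y where c: "i \<in> V" "\<forall>j\<in>V. c j \<in> K j" "x \<in> K i" "y \<in> K i"
    and det: "F (c(i := x)) * G (c(i := y)) \<noteq> F (c(i := y)) * G (c(i := x))"
    using sep_additive_pivot[OF F G V K a b] assms(7,8) by metis
  have "\<forall>j\<in>V. (c(i := z)) j \<in> K j" if "z \<in> {x, y, x + y}" for z
    using c K that by auto
  moreover have "\<exists>z\<in>{x, y, x + y}. F (c(i := z)) \<noteq> 0 \<and> G (c(i := z)) \<noteq> 0"
    using det sep_additive_upd[OF F c(1), of c x y] sep_additive_upd[OF G c(1), of c x y]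
    by auto
  ultimately show ?thesis by blast
qed (use assms in blast)

section \<open>Values of noncentral multilinear polynomials\<close>

lemma m2_conj_inverses:
  fixes x :: "'a::ring_1"
  shows "m2 0 1 1 0 ** m2 0 1 1 0 = (mat 1 :: 'a::ring_1^2^2)"
  "m2 1 x 0 1 ** m2 1 (-x) 0 1 = mat 1" "m2 1 (-x) 0 1 ** m2 1 x 0 1 = mat 1"
  "m2 1 0 x 1 ** m2 1 0 (-x) 1 = mat 1" "m2 1 0 (-x) 1 ** m2 1 0 x 1 = mat 1"
  by (simp_all add: m2_mult mat_eq_m2)

lemma mat_center_subset_scalars:
  assumes "A \<in> (mat_center :: ('r::ring_1^2^2) set)"
  shows "A = mat (A $ 1 $ 1)"
proof -
  have "A ** B = B ** A" for B
    using assms by (auto simp: mat_center_def)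
  from this[of "m2 0 1 0 0"] this[of "m2 0 0 1 0"] show ?thesis
    by (subst (asm) (1 2 3 4) m2_collapse[of A, symmetric])
      (auto simp: m2_mult mat_eq_m2 eq_m2_iff)
qed

lemma scalar_in_mat_center: "mat k \<in> (mat_center :: ('r::comm_ring_1^'n^'n) set)"
  by (simp add: mat_center_def vec_eq_iff mat_mult_nth mult_mat_nth mult.commute)

context
  fixes V and p :: "'f::field free_algebra"
  assumes p: "multilinear_in V p"
    and noncentral: "(mat_image id p :: ('f^2^2) set) \<notin> {{0}, mat_center}"
begin

interpretation base: central_hom "id :: 'f \<Rightarrow> 'f"
  by (rule central_hom_id)

text \<open>If all values were scalar, some value \<open>mat k\<close> would be nonzero; multiplying
  one variable by \<open>mat (c / k)\<close> would then reach every scalar matrix, making the image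
  the whole center.\<close>

lemma nonscalar_value: "\<exists>A \<in> (mat_image id p :: ('f^2^2) set). \<forall>k. A \<noteq> mat k"
proof (rule ccontr)
  assume "\<not> ?thesis"
  then have scalar: "\<exists>k. A = mat k" if "A \<in> mat_image id p" for A :: "'f^2^2"
    using that by blast
  have "(mat_image id p :: ('f^2^2) set) \<noteq> {}"
    by (simp add: mat_image_def)
  then obtain A :: "'f^2^2" where "A \<in> mat_image id p" "A \<noteq> 0"
    using noncentral by blast
  with scalar obtain a :: "nat \<Rightarrow> 'f^2^2" and k where a: "mat_eval id p a = mat k" and "k \<noteq> 0"
    unfolding mat_image_def by (metis mat_0 rangeE)
  obtain i where i: "i \<in> V" using multilinear_in_vars[OF p] by auto
  have "mat c \<in> (mat_image id p :: ('f^2^2) set)" for c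
  proof -
    have "a j ** mat (c / k) = mat (c / k) ** a j" for j
      by (simp add: vec_eq_iff mat_mult_nth mult_mat_nth)
    then have "mat_eval id p (a(i := a i ** mat (c / k))) = mat k ** mat (c / k)"
      using base.mat_eval_upd_mult[OF p i, of a "mat (c / k)" "a i"] a by simp
    also have "\<dots> = mat c"
      using \<open>k \<noteq> 0\<close> by (simp add: mat_eq_m2 m2_mult)
    finally show ?thesis
      unfolding mat_image_def by (metis rangeI)
  qed
  then have "(mat_image id p :: ('f^2^2) set) = mat_center"
    using scalar mat_center_subset_scalars scalar_in_mat_center by (metis subsetI subset_antisym)
  with noncentral show False by simp
qed

lemma upper_right_value: "\<exists>A \<in> (mat_image id p :: ('f^2^2) set). A $ 1 $ 2 \<noteq> 0"
proof -
  obtain A :: "'f^2^2" where A: "A \<in> mat_image id p" "\<And>k. A \<noteq> mat k"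
    using nonscalar_value by blast
  obtain a b c d where abcd: "A = m2 a b c d" using m2_collapse[of A] by metis
  consider "b \<noteq> 0" | "c \<noteq> 0" | "b = 0" "c = 0" "d - a \<noteq> 0"
    using A(2)[of a] abcd by (auto simp: mat_eq_m2)
  then show ?thesis
  proof cases
    case 1
    with A abcd show ?thesis by (intro bexI[of _ A]) auto
  next
    case 2
    have "m2 0 1 1 0 ** A ** m2 0 1 1 0 \<in> mat_image id p"
      by (rule base.mat_image_conj[OF m2_conj_inverses(1) m2_conj_inverses(1) A(1)])
    then show ?thesis using 2 by (intro bexI) (simp_all add: abcd m2_mult)
  next
    case 3
    \<comment> \<open>This transvection turns the diagonal matrix with entries \<open>a\<close>,
      \<open>d\<close> into one with upper right entry \<open>d - a\<close>.\<close>
    have "m2 1 1 0 1 ** A ** m2 1 (-1) 0 1 \<in> mat_image id p"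
      by (rule base.mat_image_conj[OF m2_conj_inverses(3) m2_conj_inverses(2) A(1)])
    then show ?thesis using 3 by (intro bexI) (simp_all add: abcd m2_mult)
  qed
qed

lemma upper_left_value: "\<exists>A \<in> (mat_image id p :: ('f^2^2) set). A $ 1 $ 1 \<noteq> 0"
proof -
  obtain A :: "'f^2^2" where A: "A \<in> mat_image id p" "A $ 1 $ 2 \<noteq> 0"
    using upper_right_value by blast
  obtain a b c d where abcd: "A = m2 a b c d" using m2_collapse[of A] by metis
  \<comment> \<open>The conjugate has upper left entry \<open>a - b\<close>, nonzero when
    \<open>a = 0\<close>.\<close>
  have conj: "m2 1 0 1 1 ** A ** m2 1 0 (-1) 1 \<in> mat_image id p"
    by (rule base.mat_image_conj[OF m2_conj_inverses(5) m2_conj_inverses(4) A(1)])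
  show ?thesis
  proof (cases "a = 0")
    case True
    then show ?thesis using conj A by (intro bexI[OF _ conj]) (simp add: abcd m2_mult)
  qed (use A abcd in \<open>intro bexI[of _ A]; simp\<close>)
qed

lemma sep_additive_entry: "sep_additive V (\<lambda>a :: nat \<Rightarrow> 'f^2^2. mat_eval id p a $ r $ s)"
  by (rule sep_additive_nth[OF base.sep_additive_mat_eval[OF p]])

text \<open>
  Conjugation by the transposition exchanges the two indices and negates degrees, hence
  preserves degrees modulo 2.
\<close>

lemma flipped_assignments:
  fixes r s :: 2
  assumes "\<exists>A \<in> (mat_image id p :: ('f^2^2) set). A $ r $ s \<noteq> 0"
  obtains a b :: "nat \<Rightarrow> 'f^2^2" and w
  where "\<forall>i\<in>V. homog 2 (w i) (a i)" "\<forall>i\<in>V. homog 2 (w i) (b i)"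
    "homog 0 (\<Sum>i\<in>V. w i) (mat_eval id p a)"
    "mat_eval id p b = m2 0 1 1 0 ** mat_eval id p a ** m2 0 1 1 0"
    "mat_eval id p a $ r $ s \<noteq> 0"
proof -
  obtain a :: "nat \<Rightarrow> 'f^2^2" and w
    where a: "\<forall>i\<in>V. homog 0 (w i) (a i)" "mat_eval id p a $ r $ s \<noteq> 0"
    using sep_additive_homog_nonzero[OF sep_additive_entry, where W = V] multilinear_in_vars[OF p] assms
    by (fastforce simp: mat_image_def)
  let ?b = "\<lambda>i. m2 0 1 1 0 ** a i ** m2 0 1 1 0"
  have flip: "m2 0 1 1 0 ** A ** m2 0 1 1 0 = m2 (A $ 2 $ 2) (A $ 2 $ 1) (A $ 1 $ 2) (A $ 1 $ 1)"
    for A :: "'f^2^2"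
    by (subst m2_collapse[of A, symmetric]) (simp only: m2_mult, simp)
  show thesis
  proof (rule that)
    show "\<forall>i\<in>V. homog 2 (w i) (a i)"
      using a(1) by (auto simp: homog_def)
    show "\<forall>i\<in>V. homog 2 (w i) (?b i)"
      using a(1) by (auto simp: homog_def flip forall_2 pos_def)
    show "homog 0 (\<Sum>i\<in>V. w i) (mat_eval id p a)"
      using a(1) by (intro homog_mat_eval[OF p]) auto
    show "mat_eval id p ?b = m2 0 1 1 0 ** mat_eval id p a ** m2 0 1 1 0"
      by (rule base.mat_eval_conj[OF m2_conj_inverses(1) m2_conj_inverses(1)])
    show "mat_eval id p a $ r $ s \<noteq> 0" by (rule a(2))
  qed
qed

text \<open>The flip carries the nonzero entry from (1, 1) to (2, 2). Both assignments have the same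
  degrees modulo 2, so they can be merged into one of these degrees where both entries are
  nonzero.\<close>

lemma invertible_diagonal_value:
  "\<exists>a b. a \<noteq> 0 \<and> b \<noteq> 0 \<and> m2 a 0 0 b \<in> (mat_image id p :: ('f^2^2) set)"
proof (rule flipped_assignments[OF upper_left_value])
  fix a b :: "nat \<Rightarrow> 'f^2^2" and w
  let ?P = "mat_eval id p :: (nat \<Rightarrow> 'f^2^2) \<Rightarrow> _"
  assume a: "\<forall>i\<in>V. homog 2 (w i) (a i)" and b: "\<forall>i\<in>V. homog 2 (w i) (b i)"
    and hom: "homog 0 (\<Sum>i\<in>V. w i) (?P a)"
    and conj: "?P b = m2 0 1 1 0 ** ?P a ** m2 0 1 1 0" and nz: "?P a $ 1 $ 1 \<noteq> 0"
  have "?P b $ 2 $ 2 \<noteq> 0"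
    using nz by (simp add: conj matrix_mult_nth sum_2)
  then have "\<exists>c. (\<forall>i\<in>V. c i \<in> Collect (homog 2 (w i))) \<and> ?P c $ 1 $ 1 \<noteq> 0 \<and> ?P c $ 2 $ 2 \<noteq> 0"
    using multilinear_in_vars[OF p] nz a b
    by (intro sep_additive_both_nonzero[OF sep_additive_entry sep_additive_entry])
      (auto intro: homog_add)
  then obtain c where c: "\<forall>i\<in>V. homog 2 (w i) (c i)" "?P c $ 1 $ 1 \<noteq> 0" "?P c $ 2 $ 2 \<noteq> 0"
    by auto
  \<comment> \<open>The nonzero entry at (1, 1) fixes the integer total degree; degree 0 modulo 2
    then means diagonal.\<close>
  have "(\<Sum>i\<in>V. w i) = 0"
    using hom nz by (auto simp: homog_def)
  then have "homog 2 0 (?P c)"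
    using homog_mat_eval[OF p, of 2 w c] c(1) by simp
  then have "?P c = m2 (?P c $ 1 $ 1) 0 0 (?P c $ 2 $ 2)"
    by (auto simp: homog_def forall_2 pos_def eq_m2_iff)
  with c(2,3) show ?thesis
    unfolding mat_image_def by (metis rangeI)
qed

lemma offdiagonal_pencil:
  "\<exists>c i x y. i \<in> V \<and> mat_eval id p (c(i := x)) = (m2 0 1 0 0 :: 'f^2^2) \<and>
    mat_eval id p (c(i := y)) = m2 0 0 1 0"
proof (rule flipped_assignments[OF upper_right_value])
  fix a b :: "nat \<Rightarrow> 'f^2^2" and w
  let ?P = "mat_eval id p :: (nat \<Rightarrow> 'f^2^2) \<Rightarrow> _"
  assume a: "\<forall>i\<in>V. homog 2 (w i) (a i)" and b: "\<forall>i\<in>V. homog 2 (w i) (b i)"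
    and hom: "homog 0 (\<Sum>i\<in>V. w i) (?P a)"
    and conj: "?P b = m2 0 1 1 0 ** ?P a ** m2 0 1 1 0" and nz: "?P a $ 1 $ 2 \<noteq> 0"
  have w: "(\<Sum>i\<in>V. w i) = 1"
    using hom nz by (auto simp: homog_def pos_def)
  \<comment> \<open>Integer degree 1 excludes the position (2, 1) of degree -1; modulo 2 these
    degrees would coincide.\<close>
  then have "?P a $ 2 $ 1 = 0"
    using hom[unfolded homog_def, rule_format, of 2 1] by (auto simp: pos_def)
  then have entries: "?P a $ 2 $ 1 = 0" "?P b $ 1 $ 2 = 0" "?P b $ 2 $ 1 \<noteq> 0"
    using nz by (simp_all add: conj matrix_mult_nth sum_2)
  have "\<exists>c i x y. i \<in> V \<and> (\<forall>j\<in>V. c j \<in> Collect (homog 2 (w j))) \<and>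
      x \<in> Collect (homog 2 (w i)) \<and> y \<in> Collect (homog 2 (w i)) \<and>
      ?P (c(i := x)) $ 1 $ 2 * ?P (c(i := y)) $ 2 $ 1 \<noteq>
      ?P (c(i := y)) $ 1 $ 2 * ?P (c(i := x)) $ 2 $ 1"
    using multilinear_in_vars[OF p] a b entries nz
    by (intro sep_additive_pivot[OF sep_additive_entry sep_additive_entry, where a = a and b = b])
      (auto intro: homog_add)
  then obtain c i x y where c: "i \<in> V" "\<forall>j\<in>V. homog 2 (w j) (c j)" "homog 2 (w i) x" "homog 2 (w i) y"
    and det: "?P (c(i := x)) $ 1 $ 2 * ?P (c(i := y)) $ 2 $ 1 \<noteq>
      ?P (c(i := y)) $ 1 $ 2 * ?P (c(i := x)) $ 2 $ 1"
    by auto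
  have offdiag: "\<exists>s t. ?P (c(i := z)) = m2 0 s t 0" if "homog 2 (w i) z" for z
  proof -
    have "homog 2 1 (?P (c(i := z)))"
      using homog_mat_eval[OF p, of 2 w "c(i := z)"] c(2) that w by simp
    then show ?thesis
      by (auto simp: homog_def forall_2 pos_def eq_m2_iff)
  qed
  from offdiag[OF c(3)] offdiag[OF c(4)] obtain s t s' t'
    where X: "?P (c(i := x)) = m2 0 s t 0" and Y: "?P (c(i := y)) = m2 0 s' t' 0" by auto
  define D where "D = s * t' - s' * t"
  have D: "D \<noteq> 0" using det by (simp add: X Y D_def)
  have comb: "?P (c(i := x ** mat g + y ** mat h)) = m2 0 (s * g + s' * h) (t * g + t' * h) 0" for g h
  proof -
    have commute: "c j ** mat g = mat g ** c j" for j g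
      by (simp add: vec_eq_iff mat_mult_nth mult_mat_nth)
    have "?P (c(i := x ** mat g + y ** mat h)) = m2 0 s t 0 ** mat g + m2 0 s' t' 0 ** mat h"
      unfolding sep_additive_upd[OF base.sep_additive_mat_eval[OF p] c(1)]
        base.mat_eval_upd_mult[OF p c(1) commute] X Y ..
    then show ?thesis by (simp add: mat_eq_m2 m2_mult m2_add)
  qed
  \<comment> \<open>Cramer's rule: the coefficients are the columns of the inverse of
    \<open>[[s, s'], [t, t']]\<close>, whose determinant is \<open>D\<close>.\<close>
  have "?P (c(i := x ** mat (t' / D) + y ** mat (- t / D))) = m2 0 1 0 0"
    "?P (c(i := x ** mat (- s' / D) + y ** mat (s / D))) = m2 0 0 1 0"
    unfolding comb using D by (simp_all add: eq_m2_iff field_simps) (simp_all add: D_def field_simps)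
  then show ?thesis using c(1) by blast
qed

section \<open>Passage from the field to a ring into which it maps centrally\<close>

context
  fixes \<phi> :: "'f \<Rightarrow> 'r::ring_1"
  assumes \<phi>: "central_hom \<phi>"
begin

interpretation central_hom \<phi> by (rule \<phi>)

text \<open>Only variable \<open>i\<close> receives arbitrary entries of \<open>'r\<close>. The
  others keep entries in the image of \<open>\<phi>\<close>, which commute with every scalar matrix,
  so \<open>s\<close> and \<open>t\<close> can be pulled out to the right.\<close>

lemma antidiagonal_in_mat_image: "m2 0 s t 0 \<in> mat_image \<phi> p"
proof -
  obtain c i and x y :: "'f^2^2" where i: "i \<in> V"
    and xy: "mat_eval id p (c(i := x)) = m2 0 1 0 0" "mat_eval id p (c(i := y)) = m2 0 0 1 0"
    using offdiagonal_pencil by blast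
  define d where "d = (\<lambda>j. map_mat \<phi> (c j))"
  have upd: "mat_eval \<phi> p (d(i := map_mat \<phi> z)) = map_mat \<phi> (mat_eval id p (c(i := z)))" for z
  proof -
    have "d(i := map_mat \<phi> z) = (\<lambda>j. map_mat \<phi> ((c(i := z)) j))"
      by (auto simp: d_def)
    then show ?thesis by (simp only: mat_eval_map_mat)
  qed
  have commute: "d j ** mat r = mat r ** d j" for j r
    by (simp add: d_def vec_eq_iff mat_mult_nth mult_mat_nth map_mat_def hom_central)
  have "mat_eval \<phi> p (d(i := map_mat \<phi> x ** mat s + map_mat \<phi> y ** mat t)) =
      map_mat \<phi> (m2 0 1 0 0) ** mat s + map_mat \<phi> (m2 0 0 1 0) ** mat t"
    unfolding sep_additive_upd[OF sep_additive_mat_eval[OF p] i]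
      mat_eval_upd_mult[OF p i commute] upd xy ..
  also have "\<dots> = m2 0 s t 0"
    by (simp add: map_mat_m2 hom_zero hom_one mat_eq_m2 m2_mult m2_add)
  finally show ?thesis
    unfolding mat_image_def by (metis rangeI)
qed

text \<open>The inverses are given as witnesses because \<open>'r\<close> is just a ring; they are
  images of inverses in the field.\<close>

lemma invertible_diagonal_in_mat_image:
  "\<exists>a b a' b'. a * a' = 1 \<and> b * b' = 1 \<and> m2 a 0 0 b \<in> mat_image \<phi> p"
proof -
  obtain a b where ab: "a \<noteq> 0" "b \<noteq> 0" "m2 a 0 0 b \<in> (mat_image id p :: ('f^2^2) set)"
    using invertible_diagonal_value by blast
  then obtain u where "m2 a 0 0 b = (mat_eval id p u :: 'f^2^2)"
    by (auto simp: mat_image_def)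
  then have "mat_eval \<phi> p (\<lambda>i. map_mat \<phi> (u i)) = m2 (\<phi> a) 0 0 (\<phi> b)"
    by (simp add: mat_eval_map_mat map_mat_m2 hom_zero flip: \<open>m2 a 0 0 b = _\<close>)
  then have "m2 (\<phi> a) 0 0 (\<phi> b) \<in> mat_image \<phi> p"
    unfolding mat_image_def by (metis rangeI)
  moreover have "\<phi> a * \<phi> (1 / a) = 1" "\<phi> b * \<phi> (1 / b) = 1"
    using ab by (simp_all add: hom_one flip: hom_mult)
  ultimately show ?thesis by blast
qed

end

end

section \<open>Products of two values\<close>

lemma (in central_hom) mat_image_mult_disjoint:
  assumes p: "multilinear_in V p" and q: "multilinear_in W q" and "V \<inter> W = {}"
    and "A \<in> mat_image \<phi> p" "B \<in> mat_image \<phi> q"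
  shows "A ** B \<in> mat_image \<phi> (p * q)"
proof -
  obtain a b where ab: "A = mat_eval \<phi> p a" "B = mat_eval \<phi> q b"
    using assms(4,5) by (auto simp: mat_image_def)
  define c where "c = (\<lambda>i. if i \<in> V then a i else b i)"
  have "mat_eval \<phi> p c = A"
    unfolding ab by (rule sep_additive_cong[OF sep_additive_mat_eval[OF p]]) (simp add: c_def)
  moreover have "mat_eval \<phi> q c = B"
    unfolding ab by (rule sep_additive_cong[OF sep_additive_mat_eval[OF q]])
      (use assms(3) in \<open>auto simp: c_def\<close>)
  ultimately have "mat_eval \<phi> (p * q) c = A ** B"
    by (simp add: mat_eval_mult)
  then show ?thesis
    unfolding mat_image_def by (metis rangeI)
qed

theorem theorem39:
  fixes p p1 p2 :: "'d::division_ring center free_algebra"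
    and V1 V2 :: "nat set"
  assumes "p = p1 * p2"
    and "multilinear_in V1 p1"
    and "multilinear_in V2 p2"
    and "V1 \<inter> V2 = {}"
    and "(mat_image id p1 :: ('d center ^ 2 ^ 2) set) \<notin> {{0}, mat_center}"
    and "(mat_image id p2 :: ('d center ^ 2 ^ 2) set) \<notin> {{0}, mat_center}"
  shows "(UNIV :: ('d ^ 2 ^ 2) set) = mat_image Rep_center p"
proof -
  interpret central_hom "Rep_center :: 'd center \<Rightarrow> 'd"
    by (rule central_hom_Rep_center)
  let ?I = "mat_image Rep_center :: 'd center free_algebra \<Rightarrow> ('d^2^2) set"
  have anti1: "m2 0 s t 0 \<in> ?I p1" and anti2: "m2 0 s t 0 \<in> ?I p2" for s t
    using antidiagonal_in_mat_image[OF _ _ central_hom_Rep_center] assms by blast+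
  have prod: "A ** B \<in> ?I p" if "A \<in> ?I p1" "B \<in> ?I p2" for A B
    using mat_image_mult_disjoint[OF assms(2-4) that] assms(1) by simp
  \<comment> \<open>Membership may be tested on any conjugate.\<close>
  have conj: "A \<in> ?I p" if inv: "h ** g = mat 1" "g ** h = mat 1" and A: "h ** A ** g \<in> ?I p" for g h A
  proof -
    have "g ** (h ** A ** g) ** h = (g ** h) ** A ** (g ** h)"
      by (simp only: matrix_mul_assoc)
    then show ?thesis
      using mat_image_conj[OF inv A] inv by simp
  qed
  have companion: "m2 0 x 1 y \<in> ?I p" for x y
  proof (cases "y = 0")
    case True
    obtain a b a' b' where "a * a' = 1" "b * b' = 1" and diag: "m2 a 0 0 b \<in> ?I p1"
      using invertible_diagonal_in_mat_image[OF assms(2,5) central_hom_Rep_center] by blast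
    then have "m2 0 x 1 0 = m2 a 0 0 b ** m2 0 (a' * x) b' 0"
      by (simp add: m2_mult flip: mult.assoc)
    then show ?thesis using prod[OF diag anti2] True by metis
  next
    case False
    \<comment> \<open>The involution \<open>m2 1 y 0 (-1)\<close> swaps the two columns of
      \<open>?h\<close>, hence is the conjugate of the transposition by \<open>?h\<close>.\<close>
    let ?h = "m2 0 y 1 (-1)" and ?h' = "m2 (inverse y) 1 (inverse y) 0"
    have "?h ** m2 0 1 1 0 ** ?h' \<in> ?I p2"
      by (rule mat_image_conj[OF _ _ anti2])
        (use False in \<open>simp_all add: m2_mult mat_eq_m2\<close>)
    then have "m2 1 y 0 (-1) \<in> ?I p2"
      using False by (simp add: m2_mult)
    from prod[OF anti1[of "- x" 1] this] show ?thesis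
      by (simp add: m2_mult)
  qed
  have lower_left: "m2 a b c d \<in> ?I p" if "c \<noteq> 0" for a b c d
  proof (rule conj)
    \<comment> \<open>The columns of \<open>?g\<close> are the first basis vector and its image
      under \<open>m2 a b c d\<close>; they form a basis as \<open>c\<close> is nonzero, and in this
      basis the matrix is a companion matrix.\<close>
    let ?g = "m2 1 a 0 c" and ?h = "m2 1 (- a * inverse c) 0 (inverse c)"
    show "?h ** ?g = mat 1" "?g ** ?h = mat 1"
      using that by (simp_all add: m2_mult mat_eq_m2 mult.assoc)
    have "(?h ** m2 a b c d ** ?g) $ 1 $ 1 = 0" "(?h ** m2 a b c d ** ?g) $ 2 $ 1 = 1"
      using that by (simp_all add: m2_mult mult.assoc)
    then show "?h ** m2 a b c d ** ?g \<in> ?I p"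
      using companion m2_collapse by metis
  qed
  have "A \<in> ?I p" for A
  proof -
    obtain a b c d where A: "A = m2 a b c d" using m2_collapse[of A] by metis
    consider "c \<noteq> 0" | "b \<noteq> 0" | "b = 0" "c = 0" by auto
    then show ?thesis
    proof cases
      case 1
      then show ?thesis using A lower_left by simp
    next
      case 2
      show ?thesis
        \<comment> \<open>Conjugation by the transposition moves \<open>b\<close> to the lower left
          corner.\<close>
        by (rule conj[OF m2_conj_inverses(1) m2_conj_inverses(1)])
          (use lower_left[OF 2] in \<open>simp add: A m2_mult\<close>)
    next
      case 3
      have "m2 a 0 0 d = m2 0 a d 0 ** m2 0 1 1 0" by (simp add: m2_mult)
      then show ?thesis using prod[OF anti1 anti2] A 3 by metis
    qed
  qed
  then show ?thesis by blast
qed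

end
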